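(* Let $\mathcal{I}$ be an interpreted system consistent with simple robot exploration, with a compact exploration space $X$. If $\mathcal{I}$ satisfies exploration liveness, then $\mathcal{I}\models\Diamond\,\mathrm{sp}(X)$.
   Context: $\Pi$ is a finite set of robots. An interpreted system $\mathcal{I}$ is a set of runs; each run $\rho$ is a sequence of global configurations indexed by discrete global time $[t]\in\mathbb{N}$; a point is a pair $(\rho,[t])$. Each configuration assigns each robot $r$ an epistemic (memory) state; $(\rho,[t])\sim_r(\rho',[t'])$ iff $r$ has the same epistemic state at both points, and for $A\subseteq\Pi$, $\sim_{D_A}=\bigcap_{r\in A}\sim_r$. The exploration space is $X\subseteq[0,1]^k$ with the Euclidean topology; to each open set $U$ corresponds an atom $\mathrm{sp}(U)$ ("$U$ has been explored"), evaluated by a valuation, with $\mathrm{sp}(V)\to\mathrm{sp}(U)$ whenever $U\subseteq V$, and the truth of finitely many $\mathrm{sp}(V_1),\dots,\mathrm{sp}(V_n)$ at a point entailing $\mathrm{sp}(V_1\cup\dots\cup V_n)$ there (space statements form a join-lattice under containment). Semantics: $K_r\varphi$ holds at a point iff $\varphi$ holds at all $\sim_r$-related points; $D_A\varphi$ likewise with $\sim_{D_A}$; $\Diamond\varphi$ holds at $(\rho,[t])$ iff $\varphi$ holds at $(\rho,[t'])$ for some $[t']\ge[t]$; $\Box\varphi:=\neg\Diamond\neg\varphi$. $\mathcal{I}\models\varphi$ means $\varphi$ holds at all points; $\mathcal{I},\rho\models\Diamond\varphi$ means $\varphi$ holds at some point of $\rho$. $\mathcal{I}$ is consistent with simple robot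 exploration if for all robots $r$ and open $U$: (agency) $\mathcal{I}\models\mathrm{sp}(U)\to D_\Pi\mathrm{sp}(U)$; (independence) whenever $D_A\mathrm{sp}(U)$ holds at a point, there are open $V_r$ ($r\in A$) with $\bigcup_{r\in A}V_r=U$ and $K_r\mathrm{sp}(V_r)$ holding there for each $r\in A$; (stability) $\mathcal{I}\models\mathrm{sp}(U)\to\Box\mathrm{sp}(U)$; (perfect recall) $\mathcal{I}\models K_r\mathrm{sp}(U)\to\Box K_r\mathrm{sp}(U)$. A run $\rho$ satisfies exploration liveness iff there is a collection $\mathcal{U}$ of open sets with $\bigcup\mathcal{U}=X$ and $\mathcal{I},\rho\models\Diamond\mathrm{sp}(U)$ for all $U\in\mathcal{U}$; $\mathcal{I}$ satisfies it iff all runs do. *)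

theory Defs
  imports "HOL-Analysis.Analysis"
begin

text \<open>
  Formulas. The atom \<open>Sp U\<close> reads "\<open>U\<close> has been explored"; it is only ever used for sets \<open>U\<close> that are
  open in the exploration space.
\<close>

datatype ('r, 'x) formula =
    Sp "'x set"
  | Neg "('r, 'x) formula"
  | Conj "('r, 'x) formula" "('r, 'x) formula"
  | Know 'r "('r, 'x) formula"
  | Dist "'r set" "('r, 'x) formula"
  | Eventually "('r, 'x) formula"

definition Imp :: "('r, 'x) formula \<Rightarrow> ('r, 'x) formula \<Rightarrow> ('r, 'x) formula" where
  "Imp \<phi> \<psi> = Neg (Conj \<phi> (Neg \<psi>))"

definition Always :: "('r, 'x) formula \<Rightarrow> ('r, 'x) formula" where
  "Always \<phi> = Neg (Eventually (Neg \<phi>))"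

type_synonym 'c run = "nat \<Rightarrow> 'c"
type_synonym 'c point = "'c run \<times> nat"

text \<open>
  Global configurations form an arbitrary type \<open>'c\<close>: they may carry more than the epistemic states,
  which are read off by \<open>estate\<close>. The valuation may depend on the whole point and not just on
  the configuration there.
\<close>

record ('c, 'r, 's, 'x) interpreted_system =
  runs :: "'c run set"
  estate :: "'c \<Rightarrow> 'r \<Rightarrow> 's"
  val :: "'c point \<Rightarrow> 'x set \<Rightarrow> bool"

definition points :: "('c, 'r, 's, 'x) interpreted_system \<Rightarrow> 'c point set" where
  "points I = runs I \<times> UNIV"

definition indist :: "('c, 'r, 's, 'x) interpreted_system \<Rightarrow> 'r \<Rightarrow> 'c point rel" where
  "indist I r = {((\<rho>, t), (\<rho>', t')). (\<rho>, t) \<in> points I \<and> (\<rho>', t') \<in> points I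
                   \<and> estate I (\<rho> t) r = estate I (\<rho>' t') r}"

text \<open>The intersection is taken within \<open>points I \<times> points I\<close>, which matters only for \<open>A = {}\<close>.\<close>

definition indist_D :: "('c, 'r, 's, 'x) interpreted_system \<Rightarrow> 'r set \<Rightarrow> 'c point rel" where
  "indist_D I A = (points I \<times> points I) \<inter> (\<Inter>r\<in>A. indist I r)"

fun sat :: "('c, 'r, 's, 'x) interpreted_system \<Rightarrow> 'c point \<Rightarrow> ('r, 'x) formula \<Rightarrow> bool" where
  "sat I p (Sp U) \<longleftrightarrow> val I p U"
| "sat I p (Neg \<phi>) \<longleftrightarrow> \<not> sat I p \<phi>"
| "sat I p (Conj \<phi> \<psi>) \<longleftrightarrow> sat I p \<phi> \<and> sat I p \<psi>"
| "sat I p (Know r \<phi>) \<longleftrightarrow> (\<forall>q. (p, q) \<in> indist I r \<longrightarrow> sat I q \<phi>)"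
| "sat I p (Dist A \<phi>) \<longleftrightarrow> (\<forall>q. (p, q) \<in> indist_D I A \<longrightarrow> sat I q \<phi>)"
| "sat I p (Eventually \<phi>) \<longleftrightarrow> (\<exists>t'\<ge>snd p. sat I (fst p, t') \<phi>)"

definition valid :: "('c, 'r, 's, 'x) interpreted_system \<Rightarrow> ('r, 'x) formula \<Rightarrow> bool" where
  "valid I \<phi> \<longleftrightarrow> (\<forall>p\<in>points I. sat I p \<phi>)"

definition run_sat_eventually ::
  "('c, 'r, 's, 'x) interpreted_system \<Rightarrow> 'c run \<Rightarrow> ('r, 'x) formula \<Rightarrow> bool" where
  "run_sat_eventually I \<rho> \<phi> \<longleftrightarrow> (\<exists>t. sat I (\<rho>, t) \<phi>)"

text \<open>Open sets are those of the subspace topology on the exploration space \<open>X\<close>.\<close>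

abbreviation open_of :: "'x::topological_space set \<Rightarrow> 'x set \<Rightarrow> bool" where
  "open_of X U \<equiv> openin (top_of_set X) U"

text \<open>
  The join axiom is required of nonempty finite families only, so it does not force \<open>Sp {}\<close> to be
  valid.
\<close>

definition space_statements ::
  "'x::topological_space set \<Rightarrow> ('c, 'r, 's, 'x) interpreted_system \<Rightarrow> bool" where
  "space_statements X I \<longleftrightarrow>
     (\<forall>U V. open_of X U \<and> open_of X V \<and> U \<subseteq> V \<longrightarrow> valid I (Imp (Sp V) (Sp U))) \<and>
     (\<forall>p\<in>points I. \<forall>\<V>. finite \<V> \<and> \<V> \<noteq> {} \<and> (\<forall>V\<in>\<V>. open_of X V \<and> sat I p (Sp V))
        \<longrightarrow> sat I p (Sp (\<Union>\<V>)))"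

definition robot_system ::
  "'r set \<Rightarrow> (real ^ 'k) set \<Rightarrow> ('c, 'r, 's, real ^ 'k) interpreted_system \<Rightarrow> bool" where
  "robot_system R X I \<longleftrightarrow> finite R \<and> X \<subseteq> cbox 0 1 \<and> space_statements X I"

definition agency ::
  "'r set \<Rightarrow> 'x::topological_space set \<Rightarrow> ('c, 'r, 's, 'x) interpreted_system \<Rightarrow> bool" where
  "agency R X I \<longleftrightarrow> (\<forall>U. open_of X U \<longrightarrow> valid I (Imp (Sp U) (Dist R (Sp U))))"

definition independence ::
  "'r set \<Rightarrow> 'x::topological_space set \<Rightarrow> ('c, 'r, 's, 'x) interpreted_system \<Rightarrow> bool" where
  "independence R X I \<longleftrightarrow>
     (\<forall>A U. \<forall>p\<in>points I. A \<subseteq> R \<and> open_of X U \<and> sat I p (Dist A (Sp U)) \<longrightarrow>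
        (\<exists>V. (\<forall>r\<in>A. open_of X (V r)) \<and> (\<Union>r\<in>A. V r) = U \<and>
             (\<forall>r\<in>A. sat I p (Know r (Sp (V r))))))"

definition stability ::
  "'x::topological_space set \<Rightarrow> ('c, 'r, 's, 'x) interpreted_system \<Rightarrow> bool" where
  "stability X I \<longleftrightarrow> (\<forall>U. open_of X U \<longrightarrow> valid I (Imp (Sp U) (Always (Sp U))))"

definition perfect_recall ::
  "'r set \<Rightarrow> 'x::topological_space set \<Rightarrow> ('c, 'r, 's, 'x) interpreted_system \<Rightarrow> bool" where
  "perfect_recall R X I \<longleftrightarrow>
     (\<forall>r\<in>R. \<forall>U. open_of X U \<longrightarrow> valid I (Imp (Know r (Sp U)) (Always (Know r (Sp U)))))"

definition simple_robot_exploration ::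
  "'r set \<Rightarrow> 'x::topological_space set \<Rightarrow> ('c, 'r, 's, 'x) interpreted_system \<Rightarrow> bool" where
  "simple_robot_exploration R X I \<longleftrightarrow>
     agency R X I \<and> independence R X I \<and> stability X I \<and> perfect_recall R X I"

text \<open>
  The collection is required to be nonempty. For nonempty \<open>X\<close> this follows from the covering
  condition; for \<open>X = {}\<close> it excludes the empty cover, which would say nothing about \<open>Sp {}\<close>.
\<close>

definition run_exploration_liveness ::
  "'x::topological_space set \<Rightarrow> ('c, 'r, 's, 'x) interpreted_system \<Rightarrow> 'c run \<Rightarrow> bool" where
  "run_exploration_liveness X I \<rho> \<longleftrightarrow>
     (\<exists>\<U>. \<U> \<noteq> {} \<and> (\<forall>U\<in>\<U>. open_of X U) \<and> \<Union>\<U> = X \<and>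
          (\<forall>U\<in>\<U>. run_sat_eventually I \<rho> (Sp U)))"

definition exploration_liveness ::
  "'x::topological_space set \<Rightarrow> ('c, 'r, 's, 'x) interpreted_system \<Rightarrow> bool" where
  "exploration_liveness X I \<longleftrightarrow> (\<forall>\<rho>\<in>runs I. run_exploration_liveness X I \<rho>)"

end

theory Submission
  imports Defs
begin

text \<open>Fix a run. Liveness covers X by open sets, each explored at some time of the run, but
  possibly infinitely many and with unbounded times. Compactness leaves finitely many of them
  (\<open>compact_nonempty_finite_subcover\<close>), so their times have a maximum. By stability
  (\<open>stability_mono\<close>) explored sets stay explored, so at that maximum all sets of the
  subcover are explored simultaneously, and the join axiom (\<open>space_statements_Union\<close>)
  turns this into the exploration of their union X.\<close>

lemma sat_Imp [simp]: "sat I p (Imp \<phi> \<psi>) \<longleftrightarrow> (sat I p \<phi> \<longrightarrow> sat I p \<psi>)"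
  by (simp add: Imp_def)

lemma sat_Always [simp]: "sat I p (Always \<phi>) \<longleftrightarrow> (\<forall>t'\<ge>snd p. sat I (fst p, t') \<phi>)"
  by (simp add: Always_def)

lemma stability_mono:
  assumes "stability X I" and "\<rho> \<in> runs I" and "open_of X U"
    and "sat I (\<rho>, t) (Sp U)" and "t \<le> t'"
  shows "sat I (\<rho>, t') (Sp U)"
proof -
  have "(\<rho>, t) \<in> points I"
    using assms(2) by (simp add: points_def)
  then have "sat I (\<rho>, t) (Imp (Sp U) (Always (Sp U)))"
    using assms(1,3) unfolding stability_def valid_def by blast
  then show ?thesis
    using assms(4,5) by simp
qed

lemma space_statements_Union:
  assumes "space_statements X I" and "p \<in> points I" and "finite \<V>" and "\<V> \<noteq> {}"
    and "\<And>V. V \<in> \<V> \<Longrightarrow> open_of X V" and "\<And>V. V \<in> \<V> \<Longrightarrow> sat I p (Sp V)"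
  shows "sat I p (Sp (\<Union>\<V>))"
proof -
  have "\<forall>p\<in>points I. \<forall>\<V>. finite \<V> \<and> \<V> \<noteq> {} \<and> (\<forall>V\<in>\<V>. open_of X V \<and> sat I p (Sp V))
      \<longrightarrow> sat I p (Sp (\<Union>\<V>))"
    using assms(1) unfolding space_statements_def by (rule conjunct2)
  then show ?thesis
    using assms(2-6) by simp
qed

text \<open>The join axiom speaks of nonempty families only, whereas compactness may return the
  empty subcover when X is empty. Adding one member of \<U> repairs this; the union remains X
  because every member of \<U> lies in X.\<close>

lemma compact_nonempty_finite_subcover:
  assumes "compact X" and "\<U> \<noteq> {}" and "\<And>U. U \<in> \<U> \<Longrightarrow> open_of X U" and "\<Union>\<U> = X"
  obtains \<V> where "\<V> \<subseteq> \<U>" "finite \<V>" "\<V> \<noteq> {}" "\<Union>\<V> = X"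
proof -
  obtain \<D> where "\<D> \<subseteq> \<U>" "finite \<D>" "X \<subseteq> \<Union>\<D>"
    using assms(1)[unfolded compact_eq_openin_cover, rule_format, of \<U>] assms(3,4) by auto
  moreover obtain U where "U \<in> \<U>"
    using assms(2) by blast
  ultimately show thesis
    using assms(4) by (intro that[of "insert U \<D>"]) auto
qed

theorem mainTheorem3:
  fixes R :: "'r set"
    and X :: "(real ^ 'k) set"
    and I :: "('c, 'r, 's, real ^ 'k) interpreted_system"
  assumes "robot_system R X I"
    and "simple_robot_exploration R X I"
    and "compact X"
    and "exploration_liveness X I"
  shows "valid I (Eventually (Sp X))"
  unfolding valid_def
proof
  fix p assume "p \<in> points I"
  then obtain \<rho> t where p: "p = (\<rho>, t)" and \<rho>: "\<rho> \<in> runs I"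
    by (auto simp: points_def)
  have space: "space_statements X I" and stable: "stability X I"
    using assms(1,2) by (auto simp: robot_system_def simple_robot_exploration_def)
  have "run_exploration_liveness X I \<rho>"
    using assms(4) \<rho> by (simp add: exploration_liveness_def)
  then obtain \<U> where "\<U> \<noteq> {}" and opn: "\<And>U. U \<in> \<U> \<Longrightarrow> open_of X U" and "\<Union>\<U> = X"
    and ev: "\<forall>U\<in>\<U>. \<exists>s. sat I (\<rho>, s) (Sp U)"
    unfolding run_exploration_liveness_def run_sat_eventually_def by (elim exE conjE) simp
  obtain \<V> where \<V>: "\<V> \<subseteq> \<U>" "finite \<V>" "\<V> \<noteq> {}" "\<Union>\<V> = X"
    by (rule compact_nonempty_finite_subcover[OF assms(3) \<open>\<U> \<noteq> {}\<close> opn \<open>\<Union>\<U> = X\<close>])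
  obtain s where s: "\<And>U. U \<in> \<U> \<Longrightarrow> sat I (\<rho>, s U) (Sp U)"
    using ev by metis
  \<comment> \<open>The times \<open>s V\<close> may all precede t, since liveness allows any time
    of the run. Including t in the maximum makes T a legitimate witness for
    \<open>Eventually\<close> at (\<rho>, t).\<close>
  define T where "T = Max (insert t (s ` \<V>))"
  have "t \<le> T" and T: "\<And>V. V \<in> \<V> \<Longrightarrow> s V \<le> T"
    using \<V>(2) by (auto simp: T_def)
  \<comment> \<open>Stability carries each V from its own time \<open>s V\<close> forward to the
    common time T.\<close>
  have "sat I (\<rho>, T) (Sp V)" if "V \<in> \<V>" for V
    using stability_mono[OF stable \<rho> opn s T] that \<V>(1) by blast
  moreover have "(\<rho>, T) \<in> points I"
    using \<rho> by (simp add: points_def)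
  moreover have "open_of X V" if "V \<in> \<V>" for V
    using opn \<V>(1) that by blast
  ultimately have "sat I (\<rho>, T) (Sp (\<Union>\<V>))"
    by (intro space_statements_Union[OF space _ \<V>(2,3)])
  then show "sat I p (Eventually (Sp X))"
    using \<open>t \<le> T\<close> \<V>(4) p by auto
qed

end
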